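(* In the limit $\hbar\to\infty$ with the Kähler parameters $z_i$ scaled so that $z_i^\sharp=z_i(-\hbar^{1/2})^{\mathbf v_i'}$ remain fixed: (1) the vertex functions $V^{(\tau)}_{\mathbf p}$ of the cotangent bundle of the partial flag variety have well-defined limits; (2) the limits of the Bethe ansatz equations $$\prod_{j=1}^{\mathbf v_{i+1}}\frac{s_{i,k}-s_{i+1,j}}{s_{i,k}-\hbar s_{i+1,j}}\prod_{j=1}^{\mathbf v_{i-1}}\frac{s_{i-1,j}-\hbar s_{i,k}}{s_{i-1,j}-s_{i,k}}=z_i(-\hbar^{1/2})^{-\mathbf v_i'}\prod_{j=1,\,j\ne k}^{\mathbf v_i}\frac{s_{i,j}-s_{i,k}\hbar}{s_{i,j}\hbar-s_{i,k}},\quad 1\le k\le\mathbf v_i,\ 1\le i\le n-1$$ (with $\mathbf v_0=0$, $\mathbf v_n=\mathbf w_{n-1}$, $s_{n,j}=a_j$) exist and take the form $$\prod_{j=1}^{\mathbf w_{n-1}}\frac{s_{n-1,k}-a_j}{a_j}\prod_{j=1}^{\mathbf v_{n-2}}\frac{s_{n-1,k}}{s_{n-2,j}-s_{n-1,k}}=z^\sharp_{n-1}\prod_{j=1,\,j\ne k}^{\mathbf v_{n-1}}\frac{-s_{n-1,k}}{s_{n-1,j}},\quad k=1,\dots,\mathbf v_{n-1},$$ $$\prod_{j=1}^{\mathbf v_{i+1}}\frac{s_{i,k}-s_{i+1,j}}{s_{i+1,j}}\prod_{j=1}^{\mathbf v_{i-1}}\frac{s_{i,k}}{s_{i-1,j}-s_{i,k}}=z^\sharp_i\prod_{j=1,\,j\ne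 k}^{\mathbf v_i}\frac{-s_{i,k}}{s_{i,j}},\quad k=1,\dots,\mathbf v_i,\ i=2,\dots,n-2,$$ $$\prod_{j=1}^{\mathbf v_2}\frac{s_{1,k}-s_{2,j}}{s_{2,j}}=z^\sharp_1\prod_{j=1,\,j\ne k}^{\mathbf v_1}\frac{-s_{1,k}}{s_{1,j}},\quad k=1,\dots,\mathbf v_1.$$
   Context: Let $\mathbf v_1\le\dots\le\mathbf v_{n-1}\le\mathbf w_{n-1}$. Put $\mathbf v_1'=\mathbf v_2$, $\mathbf v_i'=\mathbf v_{i+1}-\mathbf v_{i-1}$ for $2\le i\le n-2$, $\mathbf v_{n-1}'=\mathbf w_{n-1}-\mathbf v_{n-2}$. The torus acting on the cotangent bundle of the variety of partial flags in $\mathbb C^{\mathbf w_{n-1}}$ with dimensions $\mathbf v_1\le\dots\le\mathbf v_{n-1}$ has equivariant parameters $a_1,\dots,a_{\mathbf w_{n-1}}$ (maximal torus of $GL_{\mathbf w_{n-1}}$) and $\hbar$ (scaling the cotangent directions); $q$ is the equivariant parameter of the torus scaling the base curve $\mathbb P^1$. The vertex function $V^{(\tau)}_{\mathbf p}(z)$ is the component at a torus fixed point $\mathbf p$ of the bare vertex (generating function of equivariant pushforwards of the symmetrized virtual structure sheaf from spaces of quasimaps from $\mathbb P^1$ nonsingular at a point, with descendent insertion $\tau$) of this cotangent bundle. Explicitly, $\mathbf p$ is a chain of subsets $\{x_{1,1},\dots,x_{1,\mathbf v_1}\}\subset\dots\subset\{x_{n-1,1},\dots,x_{n-1,\mathbf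 v_{n-1}}\}\subset\{a_1,\dots,a_{\mathbf w_{n-1}}\}$, $\tau$ is a tensorial polynomial in the tautological bundles and their duals, viewed as a Laurent polynomial symmetric in each group of variables, and $$V^{(\tau)}_{\mathbf p}(z)=\sum_{(d_{i,j})\in C}z^{\mathbf d}q^{\frac12\sum_i\mathbf v_i'd_i}\prod_{i=1}^{n-1}\prod_{j,k=1}^{\mathbf v_i}\{x_{i,j}/x_{i,k}\}^{-1}_{d_{i,j}-d_{i,k}}\prod_{j=1}^{\mathbf v_{n-1}}\prod_{k=1}^{\mathbf w_{n-1}}\{x_{n-1,j}/a_k\}_{d_{n-1,j}}\prod_{i=1}^{n-2}\prod_{j=1}^{\mathbf v_i}\prod_{k=1}^{\mathbf v_{i+1}}\{x_{i,j}/x_{i+1,k}\}_{d_{i,j}-d_{i+1,k}}\ \tau(x_{i,j}q^{-d_{i,j}}),$$ a power series in the Kähler parameters $z_1,\dots,z_{n-1}$. Here $d_i=\sum_jd_{i,j}$, $z^{\mathbf d}=\prod z_i^{d_i}$, $\{x\}_d=\frac{(\hbar/x,q)_d}{(q/x,q)_d}(-q^{1/2}\hbar^{-1/2})^d$, $(x,q)_d=\varphi(x)/\varphi(q^dx)$, $\varphi(x)=\prod_{i\ge0}(1-q^ix)$. The set $C$ consists of integer collections with $d_{i,j}\ge0$ such that for each $i=1,\dots,n-2$ there are $\mathbf v_i$ distinct indices $j_1,\dots,j_{\mathbf v_i}\in\{1,\dots,\mathbf v_{i+1}\}$ with $d_{i,k}\ge d_{i+1,j_k}$.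
   Formalization: In the limiting Bethe equations z_i^♯ is replaced by (-1)^{v_i'} z_i^♯, as the printed form fails for odd v_i' (n=2, v_1=w_1=1 gives (s-a)/a=-z^♯); limits are taken after multiplying both sides by (-ħ)^{v_i'}, with fixed nonzero s_{i,j}. *)

theory Defs
  imports "HOL-Complex_Analysis.Complex_Analysis" "HOL-Library.Poly_Mapping"
begin

section \<open>q-Pochhammer symbols\<close>

definition qphi :: "complex \<Rightarrow> complex \<Rightarrow> complex" where
  "qphi q x = prodinf (\<lambda>i. 1 - q ^ i * x)"

text \<open>
  The quotient \<open>\<phi>(x) / \<phi>(q\<^sup>d x)\<close> is meant as a meromorphic function of \<open>x\<close>: both \<open>\<phi>\<close>'s vanish at
  infinitely many common points accumulating at infinity, where the quotient has a removable
  singularity. The function \<open>remove_sings\<close> fills these in and takes the value 0 at poles, so that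
  \<open>1 / (x,q)\<^sub>d\<close> is 0 at a pole, as it should be. See the two lemmas below for the
  resulting finite products.
\<close>
definition qpoch :: "complex \<Rightarrow> complex \<Rightarrow> int \<Rightarrow> complex" where
  "qpoch q x d = remove_sings (\<lambda>y. qphi q y / qphi q (q powi d * y)) x"

lemma qphi_LIMSEQ:
  assumes "norm q < 1"
  shows "(\<lambda>n. \<Prod>i\<le>n. 1 - q ^ i * x) \<longlonglongrightarrow> qphi q x"
proof -
  have "summable (\<lambda>i. norm x * norm q ^ i)"
    using assms by (intro summable_mult summable_geometric) auto
  hence "abs_convergent_prod (\<lambda>i. 1 - q ^ i * x)"
    unfolding abs_convergent_prod_conv_summable
    by (simp add: norm_mult norm_power mult.commute)
  hence "convergent_prod (\<lambda>i. 1 - q ^ i * x)"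
    by (rule abs_convergent_prod_imp_convergent_prod)
  thus ?thesis unfolding qphi_def by (rule convergent_prod_LIMSEQ)
qed

lemma qphi_eq_0_iff:
  assumes "norm q < 1"
  shows "qphi q x = 0 \<longleftrightarrow> (\<exists>i. q ^ i * x = 1)"
proof -
  have "summable (\<lambda>i. norm x * norm q ^ i)"
    using assms by (intro summable_mult summable_geometric) auto
  hence "abs_convergent_prod (\<lambda>i. 1 - q ^ i * x)"
    unfolding abs_convergent_prod_conv_summable
    by (simp add: norm_mult norm_power mult.commute)
  hence c: "convergent_prod (\<lambda>i. 1 - q ^ i * x)"
    by (rule abs_convergent_prod_imp_convergent_prod)
  hence "(\<lambda>i. 1 - q ^ i * x) has_prod qphi q x"
    unfolding qphi_def by (rule convergent_prod_has_prod)
  from has_prod_eq_0_iff[OF this] show ?thesis by (auto simp: image_iff)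
qed

lemma qphi_rec:
  assumes "norm q < 1"
  shows "qphi q x = (1 - x) * qphi q (q * x)"
proof -
  have "(\<lambda>n. (1 - x) * (\<Prod>i\<le>n. 1 - q ^ i * (q * x))) \<longlonglongrightarrow> (1 - x) * qphi q (q * x)"
    by (intro tendsto_intros qphi_LIMSEQ assms)
  moreover have "(\<lambda>n. (1 - x) * (\<Prod>i\<le>n. 1 - q ^ i * (q * x)))
      = (\<lambda>n. \<Prod>i\<le>Suc n. 1 - q ^ i * x)"
    by (rule ext, subst prod.atMost_Suc_shift) (simp add: mult_ac)
  moreover have "(\<lambda>n. \<Prod>i\<le>Suc n. 1 - q ^ i * x) \<longlonglongrightarrow> qphi q x"
    using qphi_LIMSEQ[OF assms] by (rule LIMSEQ_Suc)
  ultimately show ?thesis using LIMSEQ_unique by metis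
qed

lemma qphi_shift:
  assumes "norm q < 1"
  shows "qphi q x = (\<Prod>i<m. 1 - q ^ i * x) * qphi q (q ^ m * x)"
proof (induction m)
  case (Suc m)
  have "qphi q (q ^ m * x) = (1 - q ^ m * x) * qphi q (q ^ Suc m * x)"
    using qphi_rec[OF assms, of "q ^ m * x"] by (simp add: mult_ac)
  with Suc show ?case by (simp add: mult_ac)
qed simp

lemma eventually_qphi_nonzero:
  assumes "norm q < 1" "c \<noteq> 0"
  shows "\<forall>\<^sub>F y in at x. qphi q (c * y) \<noteq> 0"
proof -
  define B where "B = norm c * (norm x + 1)"
  have "(\<lambda>n. norm q ^ n * B) \<longlonglongrightarrow> 0 * B"
    using assms by (intro tendsto_intros LIMSEQ_power_zero) auto
  hence "\<forall>\<^sub>F n in sequentially. norm q ^ n * B < 1"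
    by (rule order_tendstoD) simp
  then obtain N where N: "\<And>n. n \<ge> N \<Longrightarrow> norm q ^ n * B < 1"
    by (auto simp: eventually_sequentially)
  define S where "S = (\<lambda>i. 1 / (q ^ i * c)) ` {..<N}"
  have "\<forall>\<^sub>F y in at x. y \<in> ball x 1 - S - {x}"
  proof -
    have "\<forall>\<^sub>F y in at x. y \<in> ball x 1 - (S - {x}) - {x}"
      by (intro eventually_at_in_open open_Diff open_ball finite_imp_closed)
         (auto simp: S_def)
    thus ?thesis by eventually_elim auto
  qed
  thus ?thesis
  proof eventually_elim
    case (elim y)
    have "norm y < norm x + 1"
      using elim norm_triangle_ineq2[of y x] by (simp add: dist_norm norm_minus_commute)
    hence less: "norm (c * y) \<le> B"
      unfolding B_def by (auto simp: norm_mult intro!: mult_left_mono)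
    show ?case
    proof
      assume "qphi q (c * y) = 0"
      then obtain i where i: "q ^ i * (c * y) = 1"
        using qphi_eq_0_iff[OF assms(1)] by blast
      hence "1 = norm q ^ i * norm (c * y)"
        unfolding norm_mult[symmetric] norm_power[symmetric] by simp
      also have "\<dots> \<le> norm q ^ i * B" using less by (intro mult_left_mono) auto
      finally have "i < N" using N[of i] by (meson not_le)
      moreover have "y = 1 / (q ^ i * c)"
      proof (rule eq_divide_imp)
        show "q ^ i * c \<noteq> 0" using i by (metis mult.assoc mult_zero_left zero_neq_one)
        show "y * (q ^ i * c) = 1" using i by (simp only: mult_ac)
      qed
      ultimately show False using elim by (auto simp: S_def)
    qed
  qed
qed

lemma qpoch_of_nat:
  assumes "norm q < 1" "q \<noteq> 0"
  shows "qpoch q x (int m) = (\<Prod>i<m. 1 - q ^ i * x)"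
proof -
  have "\<forall>\<^sub>F y in at x. qphi q y / qphi q (q powi (int m) * y) = (\<Prod>i<m. 1 - q ^ i * y)"
  proof -
    have "\<forall>\<^sub>F y in at x. qphi q (q ^ m * y) \<noteq> 0"
      using assms by (intro eventually_qphi_nonzero) auto
    thus ?thesis
    proof eventually_elim
      case (elim y)
      thus ?case by (subst qphi_shift[OF assms(1), of y m]) simp
    qed
  qed
  hence "qpoch q x (int m) = remove_sings (\<lambda>y. \<Prod>i<m. 1 - q ^ i * y) x"
    unfolding qpoch_def by (rule remove_sings_cong) simp
  also have "\<dots> = (\<Prod>i<m. 1 - q ^ i * x)"
    by (intro remove_sings_eqI tendsto_intros)
  finally show ?thesis .
qed

lemma qpoch_minus_of_nat:
  assumes "norm q < 1" "q \<noteq> 0"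
  shows "qpoch q x (- int m) = 1 / (\<Prod>i=1..m. 1 - x / q ^ i)"
proof -
  have *: "qphi q (y / q ^ m) = (\<Prod>i=1..m. 1 - y / q ^ i) * qphi q y" for y
  proof -
    have "(\<Prod>i<m. 1 - q ^ i * (y / q ^ m)) = (\<Prod>i=1..m. 1 - y / q ^ i)"
      by (rule prod.reindex_bij_witness[of _ "\<lambda>i. m - i" "\<lambda>i. m - i"])
         (use assms in \<open>auto simp: power_diff field_simps\<close>)
    thus ?thesis using qphi_shift[OF assms(1), of "y / q ^ m" m] assms by simp
  qed
  have "\<forall>\<^sub>F y in at x. qphi q y / qphi q (q powi (- int m) * y) = 1 / (\<Prod>i=1..m. 1 - y / q ^ i)"
  proof -
    have "\<forall>\<^sub>F y in at x. qphi q (1 * y) \<noteq> 0"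
      using assms by (intro eventually_qphi_nonzero) auto
    thus ?thesis
    proof eventually_elim
      case (elim y)
      have "q powi (- int m) * y = y / q ^ m"
        by (simp add: power_int_minus divide_inverse)
      thus ?case using elim *[of y] by simp
    qed
  qed
  hence "qpoch q x (- int m) = remove_sings (\<lambda>y. 1 / (\<Prod>i=1..m. 1 - y / q ^ i)) x"
    unfolding qpoch_def by (rule remove_sings_cong) simp
  also have "\<dots> = 1 / (\<Prod>i=1..m. 1 - x / q ^ i)"
  proof (cases "(\<Prod>i=1..m. 1 - x / q ^ i) = 0")
    case False
    thus ?thesis by (intro remove_sings_eqI tendsto_intros) (use assms in auto)
  next
    case True
    have "\<forall>\<^sub>F y in at x. (\<Prod>i=1..m. 1 - y / q ^ i) \<noteq> 0"
    proof -
      have "\<forall>\<^sub>F y in at x. y \<in> UNIV - ((\<lambda>i. q ^ i) ` {1..m} - {x}) - {x}"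
        by (intro eventually_at_in_open open_Diff open_UNIV finite_imp_closed) auto
      thus ?thesis
        by eventually_elim (use assms in \<open>auto simp: prod_zero_iff\<close>)
    qed
    moreover have "(\<lambda>y. \<Prod>i=1..m. 1 - y / q ^ i) \<midarrow>x\<rightarrow> 0"
      unfolding True[symmetric] by (intro tendsto_intros) (use assms in auto)
    ultimately have "is_pole (\<lambda>y. 1 / (\<Prod>i=1..m. 1 - y / q ^ i)) x"
      unfolding is_pole_def
      by (intro filterlim_divide_at_infinity[of _ 1] tendsto_const)
         (auto simp: filterlim_at)
    thus ?thesis using True by simp
  qed
  finally show ?thesis .
qed


section \<open>Vertex functions of cotangent bundles of partial flag varieties\<close>

text \<open>
  Conventions used throughout: the dimension vector is \<open>v 0 = 0, v 1, \<dots>, v (n-1), v n\<close>, where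
  \<open>v n\<close> is the dimension of the ambient space. Square roots of the equivariant parameters are
  passed as arguments: \<open>h\<close> stands for \<open>\<hbar>\<^sup>1\<^sup>/\<^sup>2\<close> and \<open>r\<close> for \<open>q\<^sup>1\<^sup>/\<^sup>2\<close>.
\<close>

text \<open>For monotone \<open>v\<close> the subtraction does not truncate, and \<open>v 0 = 0\<close> gives
  \<open>v' 1 = v 2\<close>.\<close>
definition vprime :: "(nat \<Rightarrow> nat) \<Rightarrow> nat \<Rightarrow> nat" where
  "vprime v i = v (i + 1) - v (i - 1)"

definition qbrace :: "complex \<Rightarrow> complex \<Rightarrow> complex \<Rightarrow> int \<Rightarrow> complex" where
  "qbrace r h x d =
     qpoch (r^2) (h^2 / x) d / qpoch (r^2) (r^2 / x) d * (- r / h) powi d"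

definition tautological_vars :: "nat \<Rightarrow> (nat \<Rightarrow> nat) \<Rightarrow> (nat \<times> nat) set" where
  "tautological_vars n v = (SIGMA i:{1..n-1}. {1..v i})"

text \<open>Laurent polynomials in variables indexed by pairs, as the group algebra of the free
  abelian group of exponent vectors.\<close>
type_synonym laurent = "((nat \<times> nat) \<Rightarrow>\<^sub>0 int) \<Rightarrow>\<^sub>0 complex"

definition laurent_eval :: "laurent \<Rightarrow> (nat \<Rightarrow> nat \<Rightarrow> complex) \<Rightarrow> complex" where
  "laurent_eval \<tau> y =
     (\<Sum>m\<in>Poly_Mapping.keys \<tau>. Poly_Mapping.lookup \<tau> m *
        (\<Prod>(i, j)\<in>Poly_Mapping.keys m. y i j powi Poly_Mapping.lookup m (i, j)))"

text \<open>Laurent polynomials in the Chern roots \<open>x\<^sub>i\<^sub>,\<^sub>j\<close> that are symmetric in each group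
  \<open>x\<^sub>i\<^sub>,\<^sub>1, \<dots>, x\<^sub>i\<^sub>,\<^sub>v\<^sub>i\<close> separately.\<close>
definition descendent :: "nat \<Rightarrow> (nat \<Rightarrow> nat) \<Rightarrow> laurent \<Rightarrow> bool" where
  "descendent n v \<tau> \<longleftrightarrow>
     (\<forall>m\<in>Poly_Mapping.keys \<tau>. Poly_Mapping.keys m \<subseteq> tautological_vars n v) \<and>
     (\<forall>\<pi>. \<pi> permutes tautological_vars n v \<and> (\<forall>p. fst (\<pi> p) = fst p) \<longrightarrow>
        (\<forall>m. Poly_Mapping.lookup \<tau> (Poly_Mapping.map_key \<pi> m) = Poly_Mapping.lookup \<tau> m))"

text \<open>A fixed point is a chain of subsets of the weights \<open>a\<^sub>1, \<dots>, a\<^sub>v\<^sub>n\<close>, given through an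
  enumeration \<open>x i 1, \<dots>, x i (v i)\<close> of the \<open>i\<close>-th subset.\<close>
definition fixed_point ::
    "nat \<Rightarrow> (nat \<Rightarrow> nat) \<Rightarrow> (nat \<Rightarrow> complex) \<Rightarrow> (nat \<Rightarrow> nat \<Rightarrow> complex) \<Rightarrow> bool" where
  "fixed_point n v a x \<longleftrightarrow>
     (\<forall>i\<in>{1..n-1}. inj_on (x i) {1..v i}) \<and>
     (\<forall>i\<in>{1..n-2}. x i ` {1..v i} \<subseteq> x (i + 1) ` {1..v (i + 1)}) \<and>
     x (n - 1) ` {1..v (n - 1)} \<subseteq> a ` {1..v n}"

text \<open>Genericity of the torus parameters: it makes the fixed points isolated and all factors of the
  vertex function well defined for generic \<open>\<hbar>\<close>.\<close>
definition generic_weights :: "nat \<Rightarrow> complex \<Rightarrow> (nat \<Rightarrow> complex) \<Rightarrow> bool" where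
  "generic_weights w q a \<longleftrightarrow>
     (\<forall>j\<in>{1..w}. a j \<noteq> 0) \<and>
     (\<forall>j\<in>{1..w}. \<forall>k\<in>{1..w}. j \<noteq> k \<longrightarrow> (\<forall>m::int. a j \<noteq> a k * q powi m))"

text \<open>The index set \<open>C\<close>; collections are extended by 0 outside of the relevant indices.\<close>
definition degree_cone :: "nat \<Rightarrow> (nat \<Rightarrow> nat) \<Rightarrow> (nat \<Rightarrow> nat \<Rightarrow> nat) set" where
  "degree_cone n v =
     {d. (\<forall>i j. (i, j) \<notin> tautological_vars n v \<longrightarrow> d i j = 0) \<and>
         (\<forall>i\<in>{1..n-2}. \<exists>f. inj_on f {1..v i} \<and> f ` {1..v i} \<subseteq> {1..v (i + 1)} \<and>
            (\<forall>k\<in>{1..v i}. d i k \<ge> d (i + 1) (f k)))}"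

definition total_degree :: "(nat \<Rightarrow> nat) \<Rightarrow> (nat \<Rightarrow> nat \<Rightarrow> nat) \<Rightarrow> nat \<Rightarrow> nat" where
  "total_degree v d i = (\<Sum>j=1..v i. d i j)"

text \<open>The summand of the vertex function for the collection \<open>d\<close>, without \<open>z\<^sup>d\<close>.\<close>
definition vertex_term ::
    "nat \<Rightarrow> (nat \<Rightarrow> nat) \<Rightarrow> (nat \<Rightarrow> complex) \<Rightarrow> (nat \<Rightarrow> nat \<Rightarrow> complex) \<Rightarrow> laurent \<Rightarrow>
     complex \<Rightarrow> complex \<Rightarrow> (nat \<Rightarrow> nat \<Rightarrow> nat) \<Rightarrow> complex" where
  "vertex_term n v a x \<tau> r h d =
     r ^ (\<Sum>i=1..n-1. vprime v i * total_degree v d i) *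
     (\<Prod>i=1..n-1. \<Prod>j=1..v i. \<Prod>k=1..v i.
        inverse (qbrace r h (x i j / x i k) (int (d i j) - int (d i k)))) *
     (\<Prod>j=1..v (n - 1). \<Prod>k=1..v n. qbrace r h (x (n - 1) j / a k) (int (d (n - 1) j))) *
     (\<Prod>i=1..n-2. \<Prod>j=1..v i. \<Prod>k=1..v (i + 1).
        qbrace r h (x i j / x (i + 1) k) (int (d i j) - int (d (i + 1) k))) *
     laurent_eval \<tau> (\<lambda>i j. x i j * (r^2) powi (- int (d i j)))"

text \<open>Formal power series in \<open>z\<^sub>1, \<dots>, z\<^sub>n\<^sub>-\<^sub>1\<close>, represented by their coefficients: the coefficient of
  \<open>z\<^sub>1\<^sup>e\<^sup>1 \<cdots> z\<^sub>n\<^sub>-\<^sub>1\<^sup>e\<^sup>(\<^sup>n\<^sup>-\<^sup>1\<^sup>)\<close> is the value at \<open>e\<close>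
  (only \<open>e 1, \<dots>, e (n-1)\<close> are relevant).\<close>
type_synonym kahler_series = "(nat \<Rightarrow> nat) \<Rightarrow> complex"

definition vertex ::
    "nat \<Rightarrow> (nat \<Rightarrow> nat) \<Rightarrow> (nat \<Rightarrow> complex) \<Rightarrow> (nat \<Rightarrow> nat \<Rightarrow> complex) \<Rightarrow> laurent \<Rightarrow>
     complex \<Rightarrow> complex \<Rightarrow> kahler_series" where
  "vertex n v a x \<tau> r h e =
     (\<Sum>d | d \<in> degree_cone n v \<and> (\<forall>i\<in>{1..n-1}. total_degree v d i = e i).
        vertex_term n v a x \<tau> r h d)"

text \<open>Substitution \<open>z\<^sub>i = c\<^sub>i z\<^sub>i\<^sup>\<sharp>\<close> in a power series, giving a series in the \<open>z\<^sub>i\<^sup>\<sharp>\<close>.\<close>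
definition rescale :: "nat \<Rightarrow> (nat \<Rightarrow> complex) \<Rightarrow> kahler_series \<Rightarrow> kahler_series" where
  "rescale n c F e = F e * (\<Prod>i=1..n-1. c i ^ e i)"

text \<open>The factor \<open>z\<^sub>i / z\<^sub>i\<^sup>\<sharp>\<close>, where \<open>z\<^sub>i\<^sup>\<sharp> = z\<^sub>i (-\<hbar>\<^sup>1\<^sup>/\<^sup>2)\<^bsup>v'\<^sub>i\<^esup>\<close>.\<close>
definition kahler_scale :: "(nat \<Rightarrow> nat) \<Rightarrow> complex \<Rightarrow> nat \<Rightarrow> complex" where
  "kahler_scale v h i = (- h) powi (- int (vprime v i))"


section \<open>Bethe ansatz equations\<close>

text \<open>In both sides, \<open>s n j = a\<^sub>j\<close> is understood.\<close>
definition bethe_lhs ::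
    "(nat \<Rightarrow> nat) \<Rightarrow> (nat \<Rightarrow> nat \<Rightarrow> complex) \<Rightarrow> complex \<Rightarrow> nat \<Rightarrow> nat \<Rightarrow> complex" where
  "bethe_lhs v s h i k =
     (\<Prod>j=1..v (i + 1). (s i k - s (i + 1) j) / (s i k - h^2 * s (i + 1) j)) *
     (\<Prod>j=1..v (i - 1). (s (i - 1) j - h^2 * s i k) / (s (i - 1) j - s i k))"

definition bethe_rhs ::
    "(nat \<Rightarrow> nat) \<Rightarrow> (nat \<Rightarrow> nat \<Rightarrow> complex) \<Rightarrow> (nat \<Rightarrow> complex) \<Rightarrow> complex \<Rightarrow> nat \<Rightarrow> nat \<Rightarrow> complex"
  where
  "bethe_rhs v s z h i k =
     z i * (- h) powi (- int (vprime v i)) *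
     (\<Prod>j\<in>{1..v i} - {k}. (s i j - s i k * h^2) / (s i j * h^2 - s i k))"

text \<open>
  The equation \<open>A h = B h\<close>, after multiplication of both sides by the nonvanishing factor \<open>N h\<close>,
  tends to the equation \<open>L = R\<close> as \<open>h \<rightarrow> \<infinity>\<close>. A normalisation is needed since both sides of the
  Bethe equations are of order \<open>\<hbar>\<^bsup>-v'\<^sub>i\<^esup>\<close>: the left-hand side carries \<open>(-\<hbar>)\<^bsup>-v'\<^sub>i\<^esup>\<close>, the right-hand
  side \<open>z\<^sub>i (-\<hbar>\<^sup>1\<^sup>/\<^sup>2)\<^bsup>-v'\<^sub>i\<^esup> = z\<^sub>i\<^sup>\<sharp> \<hbar>\<^bsup>-v'\<^sub>i\<^esup>\<close>. Hence, with these conventions, the parameter that enters the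
  limiting equation is \<open>(-1)\<^bsup>v'\<^sub>i\<^esup> z\<^sub>i\<^sup>\<sharp>\<close>.
\<close>
definition equation_limit ::
    "(complex \<Rightarrow> complex) \<Rightarrow> (complex \<Rightarrow> complex) \<Rightarrow> (complex \<Rightarrow> complex) \<Rightarrow> complex \<Rightarrow> complex \<Rightarrow> bool"
  where
  "equation_limit N A B L R \<longleftrightarrow>
     (\<forall>\<^sub>F h in at_infinity. N h \<noteq> 0) \<and>
     ((\<lambda>h. N h * A h) \<longlongrightarrow> L) at_infinity \<and>
     ((\<lambda>h. N h * B h) \<longlongrightarrow> R) at_infinity"

end

theory Submission
  imports Defs
begin

text \<open>
  Every factor \<open>{x}\<^sub>d\<close> is asymptotic to a constant multiple of \<open>h\<^sup>d\<close>, so each summand of the vertex function to a multiple of a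
  power of \<open>h\<close> whose exponent is linear in the degrees. The factors for a single node cancel, and
  those for two neighbouring nodes add up to \<open>\<Sum>\<^sub>i (v\<^sub>i\<^sub>+\<^sub>1 - v\<^sub>i\<^sub>-\<^sub>1) d\<^sub>i\<close>, which is exactly what the
  rescaling of the \<open>z\<^sub>i\<close> takes away. In the Bethe equations the limit can be taken factor by factor.
\<close>

section \<open>Calculus of leading powers of \<open>h\<close> at infinity\<close>

definition power_asymp :: "(complex \<Rightarrow> complex) \<Rightarrow> int \<Rightarrow> complex \<Rightarrow> bool" where
  "power_asymp f k L \<longleftrightarrow> ((\<lambda>h. f h * h powi (- k)) \<longlongrightarrow> L) at_infinity"

text \<open>The limit \<open>L\<close> may be zero, so this is an upper bound for the growth, stable
  under products and sufficient for the existence of limits. Passing to inverses requires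
  \<open>L \<noteq> 0\<close>, which is why the version \<open>power_asymp\<close> with an explicit
  constant is kept. The exponent is an integer because differences of degrees can be
  negative.\<close>

definition power_growth :: "(complex \<Rightarrow> complex) \<Rightarrow> int \<Rightarrow> bool" where
  "power_growth f k \<longleftrightarrow> (\<exists>L. power_asymp f k L)"

lemma eventually_nonzero_at_infinity:
  "\<forall>\<^sub>F h in at_infinity. h \<noteq> (0 :: 'a :: real_normed_vector)"
  unfolding eventually_at_infinity by (rule exI[of _ 1]) auto

lemma power_asymp_const: "power_asymp (\<lambda>_. c) 0 c"
  by (simp add: power_asymp_def)

lemma power_asymp_powi: "power_asymp (\<lambda>h. h powi k) k 1"
  unfolding power_asymp_def
  by (rule tendsto_eventually, use eventually_nonzero_at_infinity in eventually_elim)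
     (simp add: power_int_minus)

lemma power_asymp_mult:
  assumes "power_asymp f k L" "power_asymp g l M"
  shows "power_asymp (\<lambda>h. f h * g h) (k + l) (L * M)"
  unfolding power_asymp_def
proof (rule Lim_transform_eventually)
  show "((\<lambda>h. (f h * h powi (- k)) * (g h * h powi (- l))) \<longlongrightarrow> L * M) at_infinity"
    using assms by (intro tendsto_mult) (simp_all add: power_asymp_def)
  show "\<forall>\<^sub>F h in at_infinity.
      (f h * h powi (- k)) * (g h * h powi (- l)) = f h * g h * h powi (- (k + l))"
    using eventually_nonzero_at_infinity
  proof eventually_elim
    case (elim h)
    have "h powi (- (k + l)) = h powi (- k) * h powi (- l)"
      using elim power_int_add[of h "- k" "- l"] by simp
    thus ?case by simp
  qed
qed

lemma power_asymp_inverse: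
  assumes "power_asymp f k L" "L \<noteq> 0"
  shows "power_asymp (\<lambda>h. inverse (f h)) (- k) (inverse L)"
proof -
  have "((\<lambda>h. inverse (f h * h powi (- k))) \<longlongrightarrow> inverse L) at_infinity"
    using assms by (intro tendsto_inverse) (simp_all add: power_asymp_def)
  thus ?thesis by (simp add: power_asymp_def power_int_minus)
qed

lemma power_asymp_prod:
  assumes "\<And>i. i \<in> I \<Longrightarrow> power_asymp (f i) (k i) (L i)"
  shows "power_asymp (\<lambda>h. \<Prod>i\<in>I. f i h) (\<Sum>i\<in>I. k i) (\<Prod>i\<in>I. L i)"
  using assms
proof (induction I rule: infinite_finite_induct)
  case (insert i I)
  have "power_asymp (\<lambda>h. f i h * (\<Prod>i\<in>I. f i h)) (k i + (\<Sum>i\<in>I. k i)) (L i * (\<Prod>i\<in>I. L i))"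
    using insert by (intro power_asymp_mult) auto
  thus ?case using insert.hyps by simp
qed (simp_all add: power_asymp_const)

lemma power_growth_const: "power_growth (\<lambda>_. c) 0"
  using power_asymp_const unfolding power_growth_def by blast

lemma power_growth_mult:
  assumes "power_growth f k" "power_growth g l"
  shows "power_growth (\<lambda>h. f h * g h) (k + l)"
  using assms power_asymp_mult unfolding power_growth_def by blast

lemma power_growth_prod:
  assumes "\<And>i. i \<in> I \<Longrightarrow> power_growth (f i) (k i)"
  shows "power_growth (\<lambda>h. \<Prod>i\<in>I. f i h) (\<Sum>i\<in>I. k i)"
proof -
  obtain L where "\<And>i. i \<in> I \<Longrightarrow> power_asymp (f i) (k i) (L i)"
    using assms unfolding power_growth_def by metis
  thus ?thesis using power_asymp_prod unfolding power_growth_def by blast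
qed

text \<open>Affine functions of \<hbar> = \<open>h^2\<close> are the building blocks of both the
  finite q-Pochhammer products and the Bethe ratios. Dividing by \<open>h^2\<close> leaves a
  polynomial in \<open>inverse h\<close>, whose limit is its constant term \<open>c\<close>.\<close>

lemma power_asymp_affine_square: "power_asymp (\<lambda>h. b + c * h^2) 2 c"
  unfolding power_asymp_def
proof (rule Lim_transform_eventually)
  have "((\<lambda>h::complex. inverse h) \<longlongrightarrow> 0) at_infinity"
    by (rule tendsto_inverse_0)
  hence "((\<lambda>h::complex. b * (inverse h)^2 + c) \<longlongrightarrow> b * 0^2 + c) at_infinity"
    by (intro tendsto_intros)
  thus "((\<lambda>h::complex. b * (inverse h)^2 + c) \<longlongrightarrow> c) at_infinity"
    by simp
  show "\<forall>\<^sub>F h in at_infinity. b * (inverse h)^2 + c = (b + c * h^2) * h powi (- 2)"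
    using eventually_nonzero_at_infinity
    by eventually_elim (simp add: power_int_minus field_simps)
qed

section \<open>Growth of q-Pochhammer symbols and of the factors \<open>{x}\<^sub>d\<close>\<close>

text \<open>As a function of \<hbar>, the symbol is a polynomial of degree \<open>d\<close> for
  \<open>d \<ge> 0\<close> and the reciprocal of one of degree \<open>-d\<close> for
  \<open>d \<le> 0\<close>. The leading coefficients are nonzero since \<open>q\<close> and
  \<open>x\<close> are, so the symbol can be inverted in the asymptotics as well.\<close>

lemma qpoch_asymp:
  assumes "norm q < 1" "q \<noteq> 0" "x \<noteq> 0"
  obtains L where "L \<noteq> 0" "power_asymp (\<lambda>h. qpoch q (h^2 / x) d) (2 * d) L"
proof (cases d rule: int_cases2)
  case (nonneg m)
  have "power_asymp (\<lambda>h. \<Prod>i<m. 1 + (- (q ^ i / x)) * h^2) (\<Sum>i<m. 2) (\<Prod>i<m. - (q ^ i / x))"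
    by (intro power_asymp_prod power_asymp_affine_square)
  moreover have "(\<lambda>h. \<Prod>i<m. 1 + (- (q ^ i / x)) * h^2) = (\<lambda>h. qpoch q (h^2 / x) d)"
    using assms by (simp add: nonneg qpoch_of_nat)
  ultimately show ?thesis
    using assms nonneg by (intro that[of "\<Prod>i<m. - (q ^ i / x)"]) (simp_all add: mult.commute)
next
  case (nonpos m)
  define L where "L = (\<Prod>i=1..m. - (1 / (x * q ^ i)))"
  have "L \<noteq> 0" using assms by (simp add: L_def)
  have "power_asymp (\<lambda>h. \<Prod>i=1..m. 1 + (- (1 / (x * q ^ i))) * h^2) (\<Sum>i=1..m. 2) L"
    unfolding L_def by (intro power_asymp_prod power_asymp_affine_square)
  from power_asymp_inverse[OF this \<open>L \<noteq> 0\<close>]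
  have "power_asymp (\<lambda>h. qpoch q (h^2 / x) d) (2 * d) (inverse L)"
    using assms by (simp add: nonpos qpoch_minus_of_nat divide_inverse mult_ac)
  thus ?thesis using \<open>L \<noteq> 0\<close> by (intro that[of "inverse L"]) auto
qed

text \<open>The numerator symbol contributes exponent \<open>2 * d\<close> and the monomial
  \<open>(- r / h) powi d\<close> contributes \<open>- d\<close>; the denominator symbol does not
  involve \<open>h\<close>.\<close>

lemma
  assumes "r \<noteq> 0" "norm r < 1" "x \<noteq> 0"
  shows qbrace_growth: "power_growth (\<lambda>h. qbrace r h x d) d"
    and inverse_qbrace_growth: "power_growth (\<lambda>h. inverse (qbrace r h x d)) (- d)"
proof -
  have "norm (r^2) < 1"
    using assms by (simp add: norm_power power_less_one_iff)
  then obtain L where L: "L \<noteq> 0" "power_asymp (\<lambda>h. qpoch (r^2) (h^2 / x) d) (2 * d) L"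
    using assms by (metis qpoch_asymp power_not_zero)
  \<comment> \<open>The part independent of \<open>h\<close>. It can be zero, for instance for
    \<open>x = 1\<close> and \<open>d < 0\<close>. Then the factor and, by
    \<open>inverse 0 = 0\<close>, its inverse vanish identically, which is compatible with
    \<open>power_growth\<close>.\<close>
  define c where "c = inverse (qpoch (r^2) (r^2 / x) d) * (- r) powi d"
  have qbrace: "qbrace r h x d = qpoch (r^2) (h^2 / x) d * h powi (- d) * c" for h
  proof -
    have "(- r / h) powi d = (- r) powi d * h powi (- d)"
      unfolding power_int_divide_distrib power_int_minus by (rule divide_inverse)
    thus ?thesis by (simp add: qbrace_def c_def divide_inverse)
  qed
  have "power_growth (\<lambda>h. qpoch (r^2) (h^2 / x) d * h powi (- d) * c) (2 * d + - d + 0)"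
    unfolding power_growth_def
    by (intro exI, rule power_asymp_mult[OF power_asymp_mult[OF L(2) power_asymp_powi] power_asymp_const])
  thus "power_growth (\<lambda>h. qbrace r h x d) d" by (simp add: qbrace)
  have "power_growth (\<lambda>h. inverse (qpoch (r^2) (h^2 / x) d) * h powi d * inverse c)
      (- (2 * d) + d + 0)"
    unfolding power_growth_def
    by (intro exI, rule power_asymp_mult[OF power_asymp_mult[OF
          power_asymp_inverse[OF L(2,1)] power_asymp_powi] power_asymp_const])
  thus "power_growth (\<lambda>h. inverse (qbrace r h x d)) (- d)"
    by (simp add: qbrace power_int_minus mult_ac)
qed

section \<open>Fixed points and the exponent of \<open>h\<close> in a summand\<close>

text \<open>The chain of inclusions makes every \<open>x i j\<close> one of the weights; the
  induction descends from the top node \<open>n - 1\<close>.\<close>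

lemma fixed_point_nonzero:
  assumes "fixed_point n v a x" "\<forall>j\<in>{1..v n}. a j \<noteq> 0" "i \<in> {1..n-1}" "j \<in> {1..v i}"
  shows "x i j \<noteq> 0"
proof -
  have "i \<le> n - 1" "1 \<le> i" using assms by auto
  hence "x i ` {1..v i} \<subseteq> a ` {1..v n}"
  proof (induction i rule: inc_induct)
    case base
    thus ?case using assms(1) by (simp add: fixed_point_def)
  next
    case (step i)
    have "x i ` {1..v i} \<subseteq> x (i + 1) ` {1..v (i + 1)}"
      using assms(1) step unfolding fixed_point_def by auto
    also have "\<dots> \<subseteq> a ` {1..v n}" using step by simp
    finally show ?case .
  qed
  hence "x i j \<in> a ` {1..v n}" using assms(4) by blast
  thus ?thesis using assms(2) by force
qed

text \<open>Expresses the exponent coming from a pair of nodes through their total degrees. For two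
  equal nodes (\<open>m = l\<close>, \<open>f = g\<close>) the right-hand side is zero.\<close>

lemma sum_sum_diff_int:
  fixes f g :: "nat \<Rightarrow> nat"
  shows "(\<Sum>j=1..m. \<Sum>k=1..l. int (f j) - int (g k)) =
    int l * int (\<Sum>j=1..m. f j) - int m * int (\<Sum>k=1..l. g k)"
  by (simp add: sum_subtractf flip: sum_distrib_left)

text \<open>Ensures that the natural-number subtraction in \<open>vprime\<close> is a true
  difference. At \<open>i = 1\<close> this rests on \<open>v 0 = 0\<close>, since monotonicity is
  only assumed from node 1 on.\<close>

lemma two_step_mono:
  fixes v :: "nat \<Rightarrow> nat"
  assumes "v 0 = 0" "\<forall>i\<in>{1..n-1}. v i \<le> v (i + 1)" "i \<in> {1..n-1}"
  shows "v (i - 1) \<le> v (i + 1)"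
proof -
  have "v (i - 1) \<le> v i"
  proof (cases "i = 1")
    case False
    hence "i - 1 \<in> {1..n-1}" using assms(3) by auto
    thus ?thesis using assms(2)[rule_format, of "i - 1"] False assms(3) by simp
  qed (simp add: assms(1))
  also have "\<dots> \<le> v (i + 1)" using assms by blast
  finally show ?thesis .
qed

text \<open>Summation by parts: the isolated first summand is the missing term
  \<open>i = n - 1\<close> of the \<open>v (i+1)\<close> sum, and collecting the coefficient of each
  \<open>D i\<close> gives \<open>v (i+1) - v (i-1)\<close>.\<close>

lemma sum_vprime_total_degree:
  assumes "n \<ge> 2" "v 0 = 0" "\<forall>i\<in>{1..n-1}. v i \<le> v (i + 1)"
  shows "int (v n) * int (D (n-1)) +
      (\<Sum>i=1..n-2. int (v (i+1)) * int (D i) - int (v i) * int (D (i+1)))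
    = (\<Sum>i=1..n-1. int (vprime v i * D i))"
proof -
  define m where "m = n - 2"
  have m: "n = Suc (Suc m)" using assms(1) by (simp add: m_def)
  have vp: "int (vprime v i) = int (v (i+1)) - int (v (i-1))" if "i \<in> {1..n-1}" for i
    using two_step_mono[OF assms(2,3) that] by (simp add: vprime_def of_nat_diff)
  have "(\<Sum>i=1..n-1. int (vprime v i * D i)) =
      (\<Sum>i=1..Suc m. int (v (i+1)) * int (D i) - int (v (i-1)) * int (D i))"
    by (rule sum.cong) (simp_all add: m vp left_diff_distrib)
  also have "\<dots> = (\<Sum>i=1..Suc m. int (v (i+1)) * int (D i)) -
      (\<Sum>i=1..Suc m. int (v (i-1)) * int (D i))"
    by (simp add: sum_subtractf)
  \<comment> \<open>After the index shift the sum starts at 0, and its bottom term vanishes because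
    \<open>v 0 = 0\<close>.\<close>
  also have "(\<Sum>i=1..Suc m. int (v (i-1)) * int (D i)) = (\<Sum>i=1..m. int (v i) * int (D (i+1)))"
  proof -
    have "(\<Sum>i=Suc 0..Suc m. int (v (i-1)) * int (D i)) = (\<Sum>i=0..m. int (v i) * int (D (i+1)))"
      by (subst sum.shift_bounds_cl_Suc_ivl) simp
    also have "\<dots> = (\<Sum>i=1..m. int (v i) * int (D (i+1)))"
      by (simp add: sum.atLeast_Suc_atMost assms(2))
    finally show ?thesis by simp
  qed
  finally show ?thesis by (simp add: m sum_subtractf)
qed

section \<open>Limits of the vertex functions\<close>

lemma vertex_term_growth:
  assumes "n \<ge> 2" "v 0 = 0" "\<forall>i\<in>{1..n-1}. v i \<le> v (i + 1)"
    and "\<forall>j\<in>{1..v n}. a j \<noteq> 0" "r \<noteq> 0" "norm r < 1" "fixed_point n v a x"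
  shows "power_growth (\<lambda>h. vertex_term n v a x \<tau> r h d)
    (\<Sum>i=1..n-1. int (vprime v i * total_degree v d i))"
proof -
  have x: "x i j \<noteq> 0" if "i \<in> {1..n-1}" "j \<in> {1..v i}" for i j
    using fixed_point_nonzero assms that by blast
  \<comment> \<open>One summand per factor of \<open>vertex_term\<close>. The outer zeros belong to
    the power of \<open>r\<close> and to the descendent, both constant in \<open>h\<close>.\<close>
  have "power_growth (\<lambda>h. vertex_term n v a x \<tau> r h d)
    (0 + (\<Sum>i=1..n-1. \<Sum>j=1..v i. \<Sum>k=1..v i. - (int (d i j) - int (d i k)))
       + (\<Sum>j=1..v (n-1). \<Sum>k=1..v n. int (d (n-1) j))
       + (\<Sum>i=1..n-2. \<Sum>j=1..v i. \<Sum>k=1..v (i+1). int (d i j) - int (d (i+1) k)) + 0)"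
    unfolding vertex_term_def
    by (intro power_growth_mult power_growth_prod power_growth_const
        qbrace_growth inverse_qbrace_growth)
       (use assms x in auto)
  \<comment> \<open>The triple sum for single nodes cancels by \<open>sum_sum_diff_int\<close>; only
    the framing and the neighbouring nodes contribute.\<close>
  also have "(0 + (\<Sum>i=1..n-1. \<Sum>j=1..v i. \<Sum>k=1..v i. - (int (d i j) - int (d i k)))
       + (\<Sum>j=1..v (n-1). \<Sum>k=1..v n. int (d (n-1) j))
       + (\<Sum>i=1..n-2. \<Sum>j=1..v i. \<Sum>k=1..v (i+1). int (d i j) - int (d (i+1) k)) + 0)
     = int (v n) * int (total_degree v d (n-1)) +
      (\<Sum>i=1..n-2. int (v (i+1)) * int (total_degree v d i) - int (v i) * int (total_degree v d (i+1)))"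
    unfolding sum_negf sum_sum_diff_int total_degree_def by (simp add: sum_distrib_left)
  also have "\<dots> = (\<Sum>i=1..n-1. int (vprime v i * total_degree v d i))"
    using assms by (intro sum_vprime_total_degree)
  finally show ?thesis .
qed

text \<open>Separates the sign from the pure power of \<open>h\<close> that
  \<open>power_asymp\<close> divides by. The inverse of the sign is the sign itself.\<close>

lemma prod_kahler_scale:
  "(\<Prod>i=1..n-1. kahler_scale v h i ^ D i) =
     (- 1) powi (\<Sum>i=1..n-1. int (vprime v i * D i)) *
     h powi (- (\<Sum>i=1..n-1. int (vprime v i * D i)))"
proof -
  have "(\<Prod>i=1..n-1. kahler_scale v h i ^ D i) =
      (\<Prod>i=1..n-1. inverse ((- h) ^ (vprime v i * D i)))"
    by (simp add: kahler_scale_def power_int_minus power_inverse power_mult)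
  also have "\<dots> = inverse ((- h) ^ (\<Sum>i=1..n-1. vprime v i * D i))"
    by (simp add: power_sum prod_inversef[symmetric])
  also have "\<dots> = (- 1) ^ (\<Sum>i=1..n-1. vprime v i * D i) *
      inverse (h ^ (\<Sum>i=1..n-1. vprime v i * D i))"
    by (subst power_minus) (simp add: power_inverse[symmetric])
  finally show ?thesis by (simp add: power_int_minus flip: of_nat_mult of_nat_sum)
qed

text \<open>All collections contributing to one coefficient have the same total degrees
  \<open>e\<close>, hence the same exponent \<open>K\<close>, so a single rescaling factor makes
  every summand converge.\<close>

lemma rescaled_vertex_convergent:
  assumes "n \<ge> 2" "v 0 = 0" "\<forall>i\<in>{1..n-1}. v i \<le> v (i + 1)"
    and "\<forall>j\<in>{1..v n}. a j \<noteq> 0" "r \<noteq> 0" "norm r < 1" "fixed_point n v a x"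
  shows "\<exists>L. ((\<lambda>h. rescale n (kahler_scale v h) (vertex n v a x \<tau> r h) e) \<longlongrightarrow> L) at_infinity"
proof -
  define A where
    "A = {d. d \<in> degree_cone n v \<and> (\<forall>i\<in>{1..n-1}. total_degree v d i = e i)}"
  define K where "K = (\<Sum>i=1..n-1. int (vprime v i * e i))"
  have "\<exists>L. ((\<lambda>h. vertex_term n v a x \<tau> r h d * h powi (- K)) \<longlongrightarrow> L) at_infinity"
    if "d \<in> A" for d
  proof -
    have "(\<Sum>i=1..n-1. int (vprime v i * total_degree v d i)) = K"
      unfolding K_def using that by (intro sum.cong) (auto simp: A_def)
    thus ?thesis
      using vertex_term_growth[OF assms, of \<tau> d] by (simp add: power_growth_def power_asymp_def)
  qed
  then obtain L where L: "\<And>d. d \<in> A \<Longrightarrow>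
      ((\<lambda>h. vertex_term n v a x \<tau> r h d * h powi (- K)) \<longlongrightarrow> L d) at_infinity"
    by metis
  have "rescale n (kahler_scale v h) (vertex n v a x \<tau> r h) e =
      (\<Sum>d\<in>A. vertex_term n v a x \<tau> r h d * h powi (- K)) * (- 1) powi K" for h
    unfolding rescale_def vertex_def prod_kahler_scale A_def[symmetric] K_def[symmetric]
    by (subst sum_distrib_right[symmetric]) (simp add: mult_ac)
  moreover have "((\<lambda>h. (\<Sum>d\<in>A. vertex_term n v a x \<tau> r h d * h powi (- K)) * (- 1) powi K)
      \<longlongrightarrow> (\<Sum>d\<in>A. L d) * (- 1) powi K) at_infinity"
    by (intro tendsto_mult tendsto_sum tendsto_const L)
  ultimately show ?thesis by (simp only:) blast
qed

section \<open>Limits of the Bethe equations\<close>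

lemma tendsto_ratio_affine_square:
  assumes "d \<noteq> 0"
  shows "((\<lambda>h. (b + c * h^2) / (b' + d * h^2)) \<longlongrightarrow> c / d) (at_infinity :: complex filter)"
proof -
  have "power_asymp (\<lambda>h. (b + c * h^2) * inverse (b' + d * h^2)) (2 + - 2) (c * inverse d)"
    by (intro power_asymp_mult power_asymp_inverse power_asymp_affine_square assms)
  thus ?thesis by (simp add: power_asymp_def divide_inverse)
qed

text \<open>The normalisation is distributed over the factors: each factor of the first product
  receives \<open>- (h^2)\<close> and each factor of the second its inverse. Every factor then
  converges separately.\<close>

lemma bethe_lhs_limit:
  assumes "v (i - 1) \<le> v (i + 1)" "\<And>j. j \<in> {1..v (i + 1)} \<Longrightarrow> s (i + 1) j \<noteq> 0"
  shows "((\<lambda>h. (- (h^2)) ^ vprime v i * bethe_lhs v s h i k) \<longlongrightarrow>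
    (\<Prod>j=1..v (i+1). (s i k - s (i+1) j) / s (i+1) j) *
    (\<Prod>j=1..v (i-1). s i k / (s (i-1) j - s i k))) at_infinity"
proof (rule Lim_transform_eventually)
  \<comment> \<open>Each factor is written as a constant times a quotient of terms
    \<open>b + c * h^2\<close>; \<open>0 + (- 1) * h^2\<close> is the share of the
    normalisation.\<close>
  have "((\<lambda>h. (\<Prod>j=1..v (i+1). (s i k - s (i+1) j) *
          ((0 + (- 1) * h^2) / (s i k + (- s (i+1) j) * h^2))) *
        (\<Prod>j=1..v (i-1). inverse (s (i-1) j - s i k) *
          ((s (i-1) j + (- s i k) * h^2) / (0 + (- 1) * h^2)))) \<longlongrightarrow>
      (\<Prod>j=1..v (i+1). (s i k - s (i+1) j) * (- 1 / - s (i+1) j)) *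
      (\<Prod>j=1..v (i-1). inverse (s (i-1) j - s i k) * (- s i k / - 1))) at_infinity"
    by (rule tendsto_mult; rule tendsto_prod; rule tendsto_mult[OF tendsto_const];
        rule tendsto_ratio_affine_square) (use assms in auto)
  moreover have "x * (- 1 / - y) = x / y" "inverse y * (- x / - 1) = x / y" for x y :: complex
    by (simp_all add: divide_inverse mult.commute)
  ultimately show "((\<lambda>h. (\<Prod>j=1..v (i+1). (s i k - s (i+1) j) *
          ((0 + (- 1) * h^2) / (s i k + (- s (i+1) j) * h^2))) *
        (\<Prod>j=1..v (i-1). inverse (s (i-1) j - s i k) *
          ((s (i-1) j + (- s i k) * h^2) / (0 + (- 1) * h^2)))) \<longlongrightarrow>
      (\<Prod>j=1..v (i+1). (s i k - s (i+1) j) / s (i+1) j) *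
      (\<Prod>j=1..v (i-1). s i k / (s (i-1) j - s i k))) at_infinity"
    by (simp only:)
  show "\<forall>\<^sub>F h in at_infinity. (\<Prod>j=1..v (i+1). (s i k - s (i+1) j) *
          ((0 + (- 1) * h^2) / (s i k + (- s (i+1) j) * h^2))) *
        (\<Prod>j=1..v (i-1). inverse (s (i-1) j - s i k) *
          ((s (i-1) j + (- s i k) * h^2) / (0 + (- 1) * h^2))) =
      (- (h^2)) ^ vprime v i * bethe_lhs v s h i k"
    using eventually_nonzero_at_infinity
  proof eventually_elim
    case (elim h)
    have "(\<Prod>j=1..v (i+1). (s i k - s (i+1) j) *
          ((0 + (- 1) * h^2) / (s i k + (- s (i+1) j) * h^2))) =
        (\<Prod>j=1..v (i+1). (- (h^2)) * ((s i k - s (i+1) j) / (s i k - h^2 * s (i+1) j)))"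
      by (intro prod.cong) (simp_all add: mult_ac)
    also have "\<dots> = (- (h^2)) ^ v (i+1) *
        (\<Prod>j=1..v (i+1). (s i k - s (i+1) j) / (s i k - h^2 * s (i+1) j))"
      by (subst prod.distrib) simp
    finally have 1: "(\<Prod>j=1..v (i+1). (s i k - s (i+1) j) *
          ((0 + (- 1) * h^2) / (s i k + (- s (i+1) j) * h^2))) = \<dots>" .
    have "(\<Prod>j=1..v (i-1). inverse (s (i-1) j - s i k) *
          ((s (i-1) j + (- s i k) * h^2) / (0 + (- 1) * h^2))) =
        (\<Prod>j=1..v (i-1). inverse (- (h^2)) *
          ((s (i-1) j - h^2 * s i k) / (s (i-1) j - s i k)))"
      by (intro prod.cong) (simp_all add: divide_inverse mult_ac)
    also have "\<dots> = inverse (- (h^2)) ^ v (i-1) *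
        (\<Prod>j=1..v (i-1). (s (i-1) j - h^2 * s i k) / (s (i-1) j - s i k))"
      by (subst prod.distrib) simp
    finally have 2: "(\<Prod>j=1..v (i-1). inverse (s (i-1) j - s i k) *
          ((s (i-1) j + (- s i k) * h^2) / (0 + (- 1) * h^2))) = \<dots>" .
    \<comment> \<open>The exponent \<open>v (i+1) - v (i-1)\<close> does not truncate and
      \<open>h\<close> is nonzero, so the power splits into the shares of the two products.\<close>
    have 3: "(- (h^2)) ^ vprime v i = (- (h^2)) ^ v (i+1) * inverse (- (h^2)) ^ v (i-1)"
      using elim assms(1) unfolding vprime_def
      by (subst power_diff) (simp_all add: divide_inverse flip: power_inverse)
    show ?case unfolding 1 2 3 bethe_lhs_def by (simp only: mult_ac)
  qed
qed

text \<open>Here \<open>c\<close> is the fixed parameter \<open>z\<^sub>i\<^sup>\<sharp>\<close>. In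
  the product the leading coefficients in \<open>h^2\<close> are \<open>- s i k\<close> and
  \<open>s i j\<close>.\<close>

lemma bethe_rhs_limit:
  assumes "\<And>j. j \<in> {1..v i} \<Longrightarrow> s i j \<noteq> 0"
    and "\<And>h. h \<noteq> 0 \<Longrightarrow> z h i * (- h) ^ vprime v i = c"
  shows "((\<lambda>h. (- (h^2)) ^ vprime v i * bethe_rhs v s (z h) h i k) \<longlongrightarrow>
    (- 1) ^ vprime v i * c * (\<Prod>j\<in>{1..v i} - {k}. - s i k / s i j)) at_infinity"
proof (rule Lim_transform_eventually)
  show "((\<lambda>h. (- 1) ^ vprime v i * c *
        (\<Prod>j\<in>{1..v i} - {k}. (s i j + (- s i k) * h^2) / (- s i k + s i j * h^2))) \<longlongrightarrow>
      (- 1) ^ vprime v i * c * (\<Prod>j\<in>{1..v i} - {k}. - s i k / s i j)) at_infinity"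
    by (intro tendsto_mult tendsto_prod tendsto_const tendsto_ratio_affine_square)
       (use assms in auto)
  show "\<forall>\<^sub>F h in at_infinity. (- 1) ^ vprime v i * c *
        (\<Prod>j\<in>{1..v i} - {k}. (s i j + (- s i k) * h^2) / (- s i k + s i j * h^2)) =
      (- (h^2)) ^ vprime v i * bethe_rhs v s (z h) h i k"
    using eventually_nonzero_at_infinity
  proof eventually_elim
    case (elim h)
    \<comment> \<open>From \<open>- (h^2) = (- 1) * (- h) * (- h)\<close>: one power of
      \<open>- h\<close> cancels the prefactor in \<open>bethe_rhs\<close>, the other turns
      \<open>z h i\<close> into \<open>c\<close>, and the sign survives.\<close>
    have "(- (h^2)) ^ vprime v i = (- 1) ^ vprime v i * (- h) ^ vprime v i * (- h) ^ vprime v i"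
      by (simp add: power2_eq_square flip: power_mult_distrib)
    hence "(- (h^2)) ^ vprime v i * (z h i * (- h) powi (- int (vprime v i))) =
        (- 1) ^ vprime v i * (z h i * (- h) ^ vprime v i)"
      using elim by (simp add: power_int_minus field_simps)
    also have "\<dots> = (- 1) ^ vprime v i * c" using assms(2)[OF elim] by simp
    finally have "(- 1) ^ vprime v i * c =
        (- (h^2)) ^ vprime v i * (z h i * (- h) powi (- int (vprime v i)))" ..
    thus ?case unfolding bethe_rhs_def by simp
  qed
qed

section \<open>Limits of all vertex coefficients and of the Bethe equations at every node\<close>

theorem theorem3p6:
  fixes n w :: nat and v :: "nat \<Rightarrow> nat" and a :: "nat \<Rightarrow> complex"
  assumes n: "n \<ge> 2"
    and v0: "v 0 = 0" and vn: "v n = w"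
    and v_mono: "\<forall>i\<in>{1..n-1}. v i \<le> v (i + 1)"
    and a_nz: "\<forall>j\<in>{1..w}. a j \<noteq> 0"
  shows
    "(\<forall>r x \<tau>. r \<noteq> 0 \<and> norm r < 1 \<and> generic_weights w (r^2) a \<and>
        fixed_point n v a x \<and> descendent n v \<tau> \<longrightarrow>
        (\<exists>Vlim :: kahler_series. \<forall>e.
          ((\<lambda>h. rescale n (kahler_scale v h) (vertex n v a x \<tau> r h) e) \<longlongrightarrow> Vlim e) at_infinity)) \<and>
     (\<forall>s z zs.
        (\<forall>j\<in>{1..w}. s n j = a j) \<and>
        (\<forall>i\<in>{1..n-1}. \<forall>j\<in>{1..v i}. s i j \<noteq> 0) \<and>
        (\<forall>i\<in>{2..n-1}. \<forall>j\<in>{1..v (i-1)}. \<forall>k\<in>{1..v i}. s (i-1) j \<noteq> s i k) \<and>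
        (\<forall>h. h \<noteq> 0 \<longrightarrow> (\<forall>i\<in>{1..n-1}. z h i * (- h) ^ vprime v i = zs i)) \<longrightarrow>
        (\<forall>k\<in>{1..v (n-1)}.
          equation_limit (\<lambda>h. (- (h^2)) ^ vprime v (n-1))
            (\<lambda>h. bethe_lhs v s h (n-1) k) (\<lambda>h. bethe_rhs v s (z h) h (n-1) k)
            ((\<Prod>j=1..w. (s (n-1) k - a j) / a j) *
             (\<Prod>j=1..v (n-2). s (n-1) k / (s (n-2) j - s (n-1) k)))
            ((- 1) ^ vprime v (n-1) * zs (n-1) *
             (\<Prod>j\<in>{1..v (n-1)} - {k}. - s (n-1) k / s (n-1) j))) \<and>
        (\<forall>i\<in>{2..n-2}. \<forall>k\<in>{1..v i}.
          equation_limit (\<lambda>h. (- (h^2)) ^ vprime v i)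
            (\<lambda>h. bethe_lhs v s h i k) (\<lambda>h. bethe_rhs v s (z h) h i k)
            ((\<Prod>j=1..v (i+1). (s i k - s (i+1) j) / s (i+1) j) *
             (\<Prod>j=1..v (i-1). s i k / (s (i-1) j - s i k)))
            ((- 1) ^ vprime v i * zs i * (\<Prod>j\<in>{1..v i} - {k}. - s i k / s i j))) \<and>
        (\<forall>k\<in>{1..v 1}.
          equation_limit (\<lambda>h. (- (h^2)) ^ vprime v 1)
            (\<lambda>h. bethe_lhs v s h 1 k) (\<lambda>h. bethe_rhs v s (z h) h 1 k)
            (\<Prod>j=1..v 2. (s 1 k - s 2 j) / s 2 j)
            ((- 1) ^ vprime v 1 * zs 1 * (\<Prod>j\<in>{1..v 1} - {k}. - s 1 k / s 1 j))))"
proof (intro conjI allI impI ballI, goal_cases)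
  case (1 r x \<tau>)
  have "\<exists>L. ((\<lambda>h. rescale n (kahler_scale v h) (vertex n v a x \<tau> r h) e) \<longlongrightarrow> L) at_infinity" for e
    using 1 assms by (intro rescaled_vertex_convergent) auto
  thus ?case by metis
\<comment> \<open>The three displayed forms of the limiting equations are instances of one statement
  valid at every node.\<close>
next
  have limit: "equation_limit (\<lambda>h. (- (h^2)) ^ vprime v i)
      (\<lambda>h. bethe_lhs v s h i k) (\<lambda>h. bethe_rhs v s (z h) h i k)
      ((\<Prod>j=1..v (i+1). (s i k - s (i+1) j) / s (i+1) j) *
       (\<Prod>j=1..v (i-1). s i k / (s (i-1) j - s i k)))
      ((- 1) ^ vprime v i * zs i * (\<Prod>j\<in>{1..v i} - {k}. - s i k / s i j))"
    if s: "(\<forall>j\<in>{1..w}. s n j = a j) \<and>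
        (\<forall>i\<in>{1..n-1}. \<forall>j\<in>{1..v i}. s i j \<noteq> 0) \<and>
        (\<forall>i\<in>{2..n-1}. \<forall>j\<in>{1..v (i-1)}. \<forall>k\<in>{1..v i}. s (i-1) j \<noteq> s i k) \<and>
        (\<forall>h. h \<noteq> 0 \<longrightarrow> (\<forall>i\<in>{1..n-1}. z h i * (- h) ^ vprime v i = zs i))"
      and i: "i \<in> {1..n-1}"
    for s :: "nat \<Rightarrow> nat \<Rightarrow> complex" and z zs i k
  proof -
    have v: "v (i - 1) \<le> v (i + 1)" using two_step_mono v0 v_mono i by blast
    \<comment> \<open>These are the denominators of the limit. At the last node they are the weights
      \<open>a j\<close>, elsewhere values of \<open>s\<close> at a smaller node.\<close>
    have s1: "s (i + 1) j \<noteq> 0" if "j \<in> {1..v (i + 1)}" for j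
    proof (cases "i + 1 = n")
      case True
      thus ?thesis using s a_nz that vn by auto
    next
      case False
      hence "i + 1 \<in> {1..n-1}" using i by auto
      thus ?thesis using s that by blast
    qed
    show ?thesis
      unfolding equation_limit_def
    proof (intro conjI bethe_lhs_limit bethe_rhs_limit v s1)
      show "\<forall>\<^sub>F h in at_infinity. (- (h^2)) ^ vprime v i \<noteq> (0 :: complex)"
        using eventually_nonzero_at_infinity by eventually_elim simp
    qed (use s i in auto)
  qed
  {
    case (2 s z zs k)
    \<comment> \<open>At the last node the upper neighbour is the framing, so \<open>s n j\<close>
      becomes \<open>a j\<close> and \<open>v n\<close> becomes \<open>w\<close>.\<close>
    have "n - 1 + 1 = n" "n - 1 - 1 = n - 2" using n by auto
    moreover have "(\<Prod>j=1..w. (s (n-1) k - a j) / a j) =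
        (\<Prod>j=1..v n. (s (n-1) k - s n j) / s n j)"
      using 2 vn by (intro prod.cong) auto
    ultimately show ?case using limit[OF 2(1), of "n - 1" k] n by simp
  next
    case (3 s z zs i k)
    thus ?case by (intro limit) auto
  next
    case (4 s z zs k)
    \<comment> \<open>At the first node the product over the lower neighbour is empty because
      \<open>v 0 = 0\<close>.\<close>
    have "1 + 1 = (2 :: nat)" by simp
    thus ?case using limit[OF 4(1), of 1 k] n v0 by (simp add: numeral_2_eq_2)
  }
qed

end
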